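(* The language of all geodesic words in $BS(1,2)=\langle a,t\mid tat^{-1}=a^2\rangle$ with respect to the generating set $\{a^{\pm1},t^{\pm1}\}$ is not counter.
   Context: A word over $\{a,a^{-1},t,t^{-1}\}$ is geodesic if it has minimal length among all words over this alphabet representing the same element of $BS(1,2)$. Let $\Sigma$ be a finite alphabet and $k\ge1$. A (non-deterministic) $\mathbb Z^k$-automaton over $\Sigma$ is a finite directed graph with a start vertex, some accept vertices, and edges labelled by elements of $(\Sigma\cup\{\epsilon\})\times\mathbb Z^k$, where $\epsilon$ is the empty word. It accepts $w\in\Sigma^*$ if there is a path from the start vertex to some accept vertex whose first label components concatenate to $w$ and whose second components sum to $0\in\mathbb Z^k$. A language is $k$-counter if it is the set of words accepted by some $\mathbb Z^k$-automaton, and counter if it is $k$-counter for some $k\ge1$. *)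

theory Defs
  imports "HOL-Algebra.Group"
begin

section \<open>Presented groups\<close>

text \<open>A letter \<open>(x, True)\<close> stands for the generator \<open>x\<close>, and \<open>(x, False)\<close> for its formal inverse.\<close>

type_synonym 'g letter = "'g \<times> bool"

type_synonym 'g word = "'g letter list"

text \<open>
  For a set \<open>R\<close> of pairs of words, each pair \<open>(u, v)\<close> read as the defining relation \<open>u = v\<close>,
  this is the least congruence on the free monoid of words that contains \<open>R\<close> and the
  free cancellations. Two words are related iff they represent the same element of the group
  with the given generators and defining relations.
\<close>

inductive pres_cong :: "('g word \<times> 'g word) set \<Rightarrow> 'g word \<Rightarrow> 'g word \<Rightarrow> bool"
  for R where
  relation: "(u, v) \<in> R \<Longrightarrow> pres_cong R u v"
| cancel: "pres_cong R [(x, b), (x, \<not> b)] []"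
| refl: "pres_cong R u u"
| sym: "pres_cong R u v \<Longrightarrow> pres_cong R v u"
| trans: "pres_cong R u v \<Longrightarrow> pres_cong R v w \<Longrightarrow> pres_cong R u w"
| append: "pres_cong R u u' \<Longrightarrow> pres_cong R v v' \<Longrightarrow> pres_cong R (u @ v) (u' @ v')"

definition pres_class :: "('g word \<times> 'g word) set \<Rightarrow> 'g word \<Rightarrow> 'g word set" where
  "pres_class R w = {v. pres_cong R w v}"

definition presented_group :: "('g word \<times> 'g word) set \<Rightarrow> 'g word set monoid" where
  "presented_group R =
    \<lparr>carrier = range (pres_class R),
     mult = (\<lambda>X Y. \<Union>x\<in>X. \<Union>y\<in>Y. pres_class R (x @ y)),
     one = pres_class R []\<rparr>"

lemma pres_class_eq_iff: "pres_class R u = pres_class R v \<longleftrightarrow> pres_cong R u v"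
proof
  assume "pres_class R u = pres_class R v"
  moreover have "v \<in> pres_class R v"
    by (simp add: pres_class_def pres_cong.refl)
  ultimately have "v \<in> pres_class R u" by simp
  then show "pres_cong R u v" by (simp add: pres_class_def)
next
  assume uv: "pres_cong R u v"
  show "pres_class R u = pres_class R v"
    unfolding pres_class_def
    using pres_cong.trans[OF uv] pres_cong.trans[OF pres_cong.sym[OF uv]] by blast
qed

lemma presented_group_mult:
  "pres_class R u \<otimes>\<^bsub>presented_group R\<^esub> pres_class R v = pres_class R (u @ v)"
proof -
  have "pres_class R (x @ y) = pres_class R (u @ v)"
    if "x \<in> pres_class R u" "y \<in> pres_class R v" for x y
    unfolding pres_class_eq_iff
    using that by (intro pres_cong.sym[OF pres_cong.append]) (simp_all add: pres_class_def)
  moreover have "u \<in> pres_class R u" "v \<in> pres_class R v"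
    by (auto simp: pres_class_def intro: pres_cong.refl)
  ultimately have "(\<Union>x\<in>pres_class R u. \<Union>y\<in>pres_class R v. pres_class R (x @ y))
      = pres_class R (u @ v)"
    by blast
  then show ?thesis
    by (simp add: presented_group_def)
qed

lemma pres_cong_inverse:
  "pres_cong R (rev (map (\<lambda>(x, b). (x, \<not> b)) w) @ w) []"
proof (induction w)
  case Nil
  show ?case by (simp add: pres_cong.refl)
next
  case (Cons l w)
  obtain x b where l: "l = (x, b)" by (cases l)
  let ?r = "rev (map (\<lambda>(x, b). (x, \<not> b)) w)"
  have "pres_cong R ([(x, \<not> b), (x, b)] @ w) ([] @ w)"
    using pres_cong.cancel[of R x "\<not> b"]
    by (intro pres_cong.append pres_cong.refl) simp
  then have "pres_cong R (?r @ [(x, \<not> b), (x, b)] @ w) (?r @ w)"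
    by (intro pres_cong.append pres_cong.refl) simp
  then show ?case
    using pres_cong.trans[OF _ Cons.IH] by (simp add: l)
qed

lemma group_presented_group: "group (presented_group R)"
proof (rule groupI)
  fix X assume "X \<in> carrier (presented_group R)"
  then obtain w where "X = pres_class R w"
    by (auto simp: presented_group_def)
  then have "pres_class R (rev (map (\<lambda>(x, b). (x, \<not> b)) w)) \<otimes>\<^bsub>presented_group R\<^esub> X
      = \<one>\<^bsub>presented_group R\<^esub>"
    by (simp add: presented_group_mult)
       (simp add: presented_group_def pres_class_eq_iff pres_cong_inverse)
  then show "\<exists>Y\<in>carrier (presented_group R). Y \<otimes>\<^bsub>presented_group R\<^esub> X = \<one>\<^bsub>presented_group R\<^esub>"
    by (auto simp: presented_group_def)
next
  fix X Y assume "X \<in> carrier (presented_group R)" "Y \<in> carrier (presented_group R)"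
  then show "X \<otimes>\<^bsub>presented_group R\<^esub> Y \<in> carrier (presented_group R)"
    using presented_group_mult[of R] by (auto simp: presented_group_def)
next
  fix X Y Z
  assume "X \<in> carrier (presented_group R)" "Y \<in> carrier (presented_group R)"
    "Z \<in> carrier (presented_group R)"
  then obtain u v w where "X = pres_class R u" "Y = pres_class R v" "Z = pres_class R w"
    by (auto simp: presented_group_def)
  then show "X \<otimes>\<^bsub>presented_group R\<^esub> Y \<otimes>\<^bsub>presented_group R\<^esub> Z
      = X \<otimes>\<^bsub>presented_group R\<^esub> (Y \<otimes>\<^bsub>presented_group R\<^esub> Z)"
    by (simp add: presented_group_mult)
next
  show "\<one>\<^bsub>presented_group R\<^esub> \<in> carrier (presented_group R)"
    by (auto simp: presented_group_def)
next
  fix X assume "X \<in> carrier (presented_group R)"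
  then obtain w where "X = pres_class R w"
    by (auto simp: presented_group_def)
  then show "\<one>\<^bsub>presented_group R\<^esub> \<otimes>\<^bsub>presented_group R\<^esub> X = X"
    using presented_group_mult[of R "[]" w] by (simp add: presented_group_def)
qed


section \<open>Geodesic words\<close>

definition letter_value :: "('e, 'm) monoid_scheme \<Rightarrow> ('g \<Rightarrow> 'e) \<Rightarrow> 'g letter \<Rightarrow> 'e" where
  "letter_value G \<phi> l = (if snd l then \<phi> (fst l) else inv\<^bsub>G\<^esub> (\<phi> (fst l)))"

definition word_value :: "('e, 'm) monoid_scheme \<Rightarrow> ('g \<Rightarrow> 'e) \<Rightarrow> 'g word \<Rightarrow> 'e" where
  "word_value G \<phi> w = foldr (\<lambda>l x. letter_value G \<phi> l \<otimes>\<^bsub>G\<^esub> x) w \<one>\<^bsub>G\<^esub>"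

definition geodesic :: "('e, 'm) monoid_scheme \<Rightarrow> ('g \<Rightarrow> 'e) \<Rightarrow> 'g word \<Rightarrow> bool" where
  "geodesic G \<phi> w \<longleftrightarrow>
    (\<forall>v. word_value G \<phi> v = word_value G \<phi> w \<longrightarrow> length w \<le> length v)"

definition pres_gen :: "('g word \<times> 'g word) set \<Rightarrow> 'g \<Rightarrow> 'g word set" where
  "pres_gen R x = pres_class R [(x, True)]"

lemma word_value_presented_group:
  "word_value (presented_group R) (pres_gen R) w = pres_class R w"
proof (induction w)
  case Nil
  show ?case by (simp add: word_value_def presented_group_def)
next
  case (Cons l w)
  interpret group "presented_group R" by (rule group_presented_group)
  obtain x b where l: "l = (x, b)" by (cases l)
  have "inv\<^bsub>presented_group R\<^esub> pres_class R [(x, True)] = pres_class R [(x, False)]"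
  proof (rule inv_equality)
    show "pres_class R [(x, False)] \<otimes>\<^bsub>presented_group R\<^esub> pres_class R [(x, True)]
        = \<one>\<^bsub>presented_group R\<^esub>"
      using pres_cong.cancel[of R x False]
      by (simp add: presented_group_mult) (simp add: presented_group_def pres_class_eq_iff)
  qed (auto simp: presented_group_def)
  then have "letter_value (presented_group R) (pres_gen R) l = pres_class R [l]"
    by (simp add: letter_value_def pres_gen_def l)
  then show ?case
    using Cons.IH by (simp add: word_value_def presented_group_mult)
qed


section \<open>The Baumslag--Solitar group BS(1,2)\<close>

datatype bs_gen = Gen_a | Gen_t

definition BS12_relations :: "(bs_gen word \<times> bs_gen word) set" where
  "BS12_relations =
    {([(Gen_t, True), (Gen_a, True), (Gen_t, False)], [(Gen_a, True), (Gen_a, True)])}"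

definition BS12 :: "bs_gen word set monoid" where
  "BS12 = presented_group BS12_relations"

definition BS12_gen :: "bs_gen \<Rightarrow> bs_gen word set" where
  "BS12_gen = pres_gen BS12_relations"

definition BS12_geodesics :: "bs_gen word set" where
  "BS12_geodesics = {w. geodesic BS12 BS12_gen w}"


section \<open>Counter languages\<close>

text \<open>
  An edge is \<open>(p, x, c, q)\<close> with source \<open>p\<close>, target \<open>q\<close>, first label \<open>x\<close> (where \<open>None\<close> is the
  empty word) and second label \<open>c\<close>. Vectors in \<open>\<int>\<^sup>k\<close> are integer lists of length \<open>k\<close>, so that \<open>k\<close>
  can be quantified over.
\<close>

type_synonym ('v, 'a) edge = "'v \<times> 'a option \<times> int list \<times> 'v"

record ('v, 'a) automaton =
  verts :: "'v set"
  start :: 'v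
  accept :: "'v set"
  edges :: "('v, 'a) edge set"

definition Zk_automaton :: "'a set \<Rightarrow> nat \<Rightarrow> ('v, 'a) automaton \<Rightarrow> bool" where
  "Zk_automaton \<Sigma> k M \<longleftrightarrow>
    finite \<Sigma> \<and> finite (verts M) \<and> finite (edges M) \<and>
    start M \<in> verts M \<and> accept M \<subseteq> verts M \<and>
    (\<forall>(p, x, c, q) \<in> edges M.
      p \<in> verts M \<and> q \<in> verts M \<and> set_option x \<subseteq> \<Sigma> \<and> length c = k)"

fun is_path :: "('v, 'a) automaton \<Rightarrow> 'v \<Rightarrow> ('v, 'a) edge list \<Rightarrow> 'v \<Rightarrow> bool" where
  "is_path M p [] q \<longleftrightarrow> p = q"
| "is_path M p (e # es) q \<longleftrightarrow>
    e \<in> edges M \<and> fst e = p \<and> is_path M (snd (snd (snd e))) es q"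

definition path_word :: "('v, 'a) edge list \<Rightarrow> 'a list" where
  "path_word es =
    concat (map (\<lambda>(p, x, c, q). case x of None \<Rightarrow> [] | Some s \<Rightarrow> [s]) es)"

definition path_count :: "('v, 'a) edge list \<Rightarrow> nat \<Rightarrow> int" where
  "path_count es i = sum_list (map (\<lambda>(p, x, c, q). c ! i) es)"

definition accepts :: "nat \<Rightarrow> ('v, 'a) automaton \<Rightarrow> 'a list \<Rightarrow> bool" where
  "accepts k M w \<longleftrightarrow>
    (\<exists>es. \<exists>q \<in> accept M. is_path M (start M) es q \<and> path_word es = w \<and>
      (\<forall>i<k. path_count es i = 0))"

text \<open>
  HOL cannot quantify existentially over the type of vertices. Taking vertices in \<open>nat\<close>
  loses no generality, since the vertex set is finite.
\<close>

definition k_counter :: "'a set \<Rightarrow> nat \<Rightarrow> 'a list set \<Rightarrow> bool" where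
  "k_counter \<Sigma> k L \<longleftrightarrow>
    (\<exists>M :: (nat, 'a) automaton. Zk_automaton \<Sigma> k M \<and> L = {w. accepts k M w})"

definition counter :: "'a set \<Rightarrow> 'a list set \<Rightarrow> bool" where
  "counter \<Sigma> L \<longleftrightarrow> (\<exists>k\<ge>1. k_counter \<Sigma> k L)"

lemma finite_UNIV_bs_letter: "finite (UNIV :: bs_gen letter set)"
proof -
  have "g \<in> {Gen_a, Gen_t}" for g
    by (cases g) simp_all
  then have "finite (UNIV :: bs_gen set)"
    by (intro finite_subset[of UNIV "{Gen_a, Gen_t}"]) auto
  then show ?thesis
    by (simp add: finite_prod)
qed

end

theory Submission imports Defs Complex_Main begin

text \<open>
  A \<open>\<int>\<^sup>k\<close>-automaton has finitely many states and its counters commute. If an accepting path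
  passes three times through the same state, the two loops between these visits can be exchanged
  without changing the sum of the counters. So any sufficiently long sequence of factors of a word
  of a counter language contains two adjacent nonempty groups of factors whose exchange yields
  another word of the language (\<open>k_counter_adjacent_swap\<close>). It remains to find geodesics of
  \<open>BS(1,2)\<close> in which no such exchange gives a geodesic.

  In \<open>BS(1,2)\<close> the letter \<open>a\<close> read at height \<open>l\<close> (the exponent sum of \<open>t\<close> so far) contributes
  \<open>2\<^sup>l\<close>. A word that climbs from height \<open>0\<close> to some height and comes back therefore represents
  \<open>a\<^sup>n\<close>, where the digit of \<open>n\<close> at height \<open>l\<close> is the number of letters \<open>a\<close> minus the number of
  letters \<open>a\<^sup>-\<^sup>1\<close> read at that height, no matter whether on the way up or on the way down. Let the
  digits be \<open>1\<close> or \<open>-1\<close> at every even height below the top, and \<open>3\<close> at the top, and place each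
  digit \<open>1\<close> on the way up and each digit \<open>-1\<close> on the way down. All these words, the
  \<open>excursion\<close>s of a bit list with itself, are geodesic: nonzero signed binary digits that are
  never adjacent cannot be replaced by a cheaper expansion, and the digit \<open>3\<close> makes it worthwhile
  to climb all the way (\<open>geodesic_excursion\<close>).

  The way up and the way down thus carry complementary information, and an exchange inside the way
  up destroys the match. If some height gets an \<open>a\<close> on the way up while it keeps its \<open>a\<^sup>-\<^sup>1\<close> on
  the way down, then the subword between the two letters is a power of \<open>a\<close>, the two letters cancel,
  and the word is not geodesic (\<open>not_geodesic_excursion\<close>). A bit list made of ever longer blocks
  is such that every exchange of two adjacent groups of blocks creates such a height
  (\<open>block_swap_mismatch\<close>).
\<close>

section \<open>Swapping factors of words of a counter language\<close>

lemma is_path_append: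
  "is_path M p (es @ fs) q \<longleftrightarrow> (\<exists>r. is_path M p es r \<and> is_path M r fs q)"
  by (induction es arbitrary: p) auto

lemma is_path_suffix: "is_path M p es r \<Longrightarrow> is_path M p (es @ fs) q \<Longrightarrow> is_path M r fs q"
  by (induction es arbitrary: p) auto

lemma is_path_end_in_verts:
  assumes "Zk_automaton \<Sigma> k M" "is_path M p es q" "p \<in> verts M"
  shows "q \<in> verts M"
  using assms(2,3)
proof (induction es arbitrary: p)
  case (Cons e es)
  obtain x y c z where e: "e = (x, y, c, z)" by (cases e)
  with Cons.prems assms(1) have "z \<in> verts M"
    by (auto simp: Zk_automaton_def)
  with Cons.IH[of z] Cons.prems e show ?case by simp
qed simp

lemma path_word_append: "path_word (es @ fs) = path_word es @ path_word fs"
  by (simp add: path_word_def)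

lemma path_word_concat: "path_word (concat ess) = concat (map path_word ess)"
  by (induction ess) (simp_all add: path_word_append, simp add: path_word_def)

lemma path_count_append: "path_count (es @ fs) i = path_count es i + path_count fs i"
  by (simp add: path_count_def)

text \<open>Edges labelled by the empty word may go to either part, so the splitting is not unique.\<close>

lemma path_word_eq_appendE:
  assumes "path_word es = u @ v"
  obtains es1 es2 where "es = es1 @ es2" "path_word es1 = u" "path_word es2 = v"
proof -
  have "\<exists>es1 es2. es = es1 @ es2 \<and> path_word es1 = u \<and> path_word es2 = v"
    using assms
  proof (induction es arbitrary: u)
    case Nil
    then show ?case by (simp add: path_word_def)
  next
    case (Cons e es)
    obtain x y c z where e: "e = (x, y, c, z)" by (cases e)
    show ?case
    proof (cases u)
      case Nil
      then show ?thesis using Cons.prems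
        by (intro exI[of _ "[]"] exI[of _ "e # es"]) (simp add: path_word_def)
    next
      case (Cons s u')
      show ?thesis
      proof (cases y)
        case None
        then have "path_word es = u @ v"
          using Cons.prems e by (simp add: path_word_def)
        from Cons.IH[OF this] obtain es1 es2
          where "es = es1 @ es2" "path_word es1 = u" "path_word es2 = v" by blast
        then show ?thesis using None e
          by (intro exI[of _ "e # es1"] exI[of _ es2]) (simp add: path_word_def)
      next
        case (Some s')
        then have "path_word es = u' @ v" "s' = s"
          using Cons.prems e \<open>u = s # u'\<close> by (simp_all add: path_word_def)
        from Cons.IH[OF this(1)] obtain es1 es2
          where "es = es1 @ es2" "path_word es1 = u'" "path_word es2 = v" by blast
        then show ?thesis using Some e \<open>u = s # u'\<close> \<open>s' = s\<close>
          by (intro exI[of _ "e # es1"] exI[of _ es2]) (simp add: path_word_def)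
      qed
    qed
  qed
  with that show thesis by blast
qed

lemma path_word_eq_concatE:
  assumes "path_word es = concat ws @ z"
  obtains ess fs where "es = concat ess @ fs" "map path_word ess = ws" "path_word fs = z"
proof -
  have "\<exists>ess fs. es = concat ess @ fs \<and> map path_word ess = ws \<and> path_word fs = z"
    using assms
  proof (induction ws arbitrary: es)
    case Nil
    then show ?case by auto
  next
    case (Cons w ws)
    then have "path_word es = w @ concat ws @ z" by simp
    then obtain es1 es2
      where 1: "es = es1 @ es2" "path_word es1 = w" "path_word es2 = concat ws @ z"
      by (rule path_word_eq_appendE)
    from Cons.IH[OF 1(3)] obtain ess fs
      where "es2 = concat ess @ fs" "map path_word ess = ws" "path_word fs = z" by blast
    with 1 show ?case
      by (intro exI[of _ "es1 # ess"] exI[of _ fs]) simp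
  qed
  with that show thesis by blast
qed

lemma pigeonhole_three:
  fixes f :: "nat \<Rightarrow> 'b"
  assumes "finite V" "f ` {..2 * card V} \<subseteq> V"
  shows "\<exists>i j l. i < j \<and> j < l \<and> l \<le> 2 * card V \<and> f i = f j \<and> f j = f l"
proof -
  let ?I = "\<lambda>v. {i \<in> {..2 * card V}. f i = v}"
  have "\<exists>v\<in>V. 2 < card (?I v)"
  proof (rule ccontr)
    assume "\<not> ?thesis"
    then have "card (?I v) \<le> 2" if "v \<in> V" for v using that by force
    moreover have "{..2 * card V} = (\<Union>v\<in>V. ?I v)" using assms(2) by auto
    then have "card {..2 * card V} \<le> (\<Sum>v\<in>V. card (?I v))"
      using card_UN_le[OF assms(1), of ?I] by metis
    ultimately have "card {..2 * card V} \<le> (\<Sum>v\<in>V. 2)"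
      using sum_mono[of V "\<lambda>v. card (?I v)" "\<lambda>_. 2"] by (metis (no_types, lifting) order_trans)
    then show False by simp
  qed
  then obtain v where v: "2 < card (?I v)" by blast
  then obtain T where T: "T \<subseteq> ?I v" "card T = 3"
    using obtain_subset_with_card_n[of 3 "?I v"] by auto
  then obtain x y z where xyz: "T = {x, y, z}" "x \<noteq> y" "y \<noteq> z" "x \<noteq> z"
    by (auto simp: card_3_iff)
  have *: "i < j \<and> j < l \<longrightarrow> ?thesis" if "i \<in> T" "j \<in> T" "l \<in> T" for i j l
  proof -
    have "f i = f j" "f j = f l" "l \<le> 2 * card V" using that T(1) by auto
    then show ?thesis by blast
  qed
  have "x \<in> T" "y \<in> T" "z \<in> T" by (simp_all add: xyz(1))
  note orders = *[OF this] *[OF this(1,3,2)] *[OF this(2,1,3)] *[OF this(2,3,1)]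
    *[OF this(3,1,2)] *[OF this(3,2,1)]
  consider "x < y \<and> y < z" | "x < z \<and> z < y" | "y < x \<and> x < z" | "y < z \<and> z < x"
    | "z < x \<and> x < y" | "z < y \<and> y < x"
    using xyz(2-4) by linarith
  then show ?thesis by cases (erule orders[THEN mp])+
qed

text \<open>
  The exchange is stated for a list \<open>ws\<close> of chosen factors, so that the places where a word may be
  cut can be prescribed. This matters because words with squares, such as powers of \<open>t\<close>, have
  exchanges that do not change them.
\<close>

lemma k_counter_adjacent_swap:
  assumes "k_counter \<Sigma> k L"
  shows "\<exists>N. \<forall>ws z. N \<le> length ws \<longrightarrow> concat ws @ z \<in> L \<longrightarrow>
    (\<exists>us xs ys zs. ws = us @ xs @ ys @ zs \<and> xs \<noteq> [] \<and> ys \<noteq> [] \<and>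
      concat (us @ ys @ xs @ zs) @ z \<in> L)"
proof -
  obtain M :: "(nat, 'a) automaton" where M: "Zk_automaton \<Sigma> k M" and L: "L = {w. accepts k M w}"
    using assms by (auto simp: k_counter_def)
  have fin: "finite (verts M)" and start: "start M \<in> verts M"
    using M by (auto simp: Zk_automaton_def)
  show ?thesis
  proof (intro exI[of _ "2 * card (verts M)"] allI impI)
    fix ws z assume len: "2 * card (verts M) \<le> length ws" and "concat ws @ z \<in> L"
    then obtain es q where q: "q \<in> accept M" and path: "is_path M (start M) es q"
      and word: "path_word es = concat ws @ z" and count: "\<forall>i<k. path_count es i = 0"
      by (auto simp: L accepts_def)
    from word obtain ess fs
      where es: "es = concat ess @ fs" and ess: "map path_word ess = ws" and fs: "path_word fs = z"
      by (rule path_word_eq_concatE)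
    \<comment> \<open>\<open>f i\<close> will be the state reached after reading the first \<open>i\<close> factors.\<close>
    have "\<exists>r. is_path M (start M) (concat (take i ess)) r" for i
    proof -
      have "es = concat (take i ess) @ concat (drop i ess) @ fs"
        unfolding es append_assoc[symmetric] concat_append[symmetric] append_take_drop_id ..
      with path show ?thesis by (auto simp: is_path_append)
    qed
    then obtain f where f: "\<And>i. is_path M (start M) (concat (take i ess)) (f i)" by metis
    have "f ` {..2 * card (verts M)} \<subseteq> verts M"
      using is_path_end_in_verts[OF M f start] by auto
    then obtain i j l where ijl: "i < j" "j < l" "l \<le> 2 * card (verts M)"
      and eq: "f i = f j" "f j = f l"
      using pigeonhole_three[OF fin, of f] by blast
    define U X Y Z where "U = take i ess" and "X = drop i (take j ess)"
      and "Y = drop j (take l ess)" and "Z = drop l ess"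
    have j: "take j ess = U @ X"
      using append_take_drop_id[of i "take j ess"] ijl by (simp add: U_def X_def min_def)
    have "take l ess = take j ess @ Y"
      using append_take_drop_id[of j "take l ess"] ijl by (simp add: Y_def min_def)
    with j have l: "take l ess = U @ X @ Y" by simp
    have all: "ess = U @ X @ Y @ Z"
      using append_take_drop_id[of l ess] by (simp add: l Z_def)
    have lenl: "length ess = length ws" using ess by (metis length_map)
    have ne: "X \<noteq> []" "Y \<noteq> []"
      using ijl len lenl by (auto simp: X_def Y_def)
    have pU: "is_path M (start M) (concat U) (f i)" using f[of i] by (simp add: U_def)
    have "is_path M (start M) (concat U @ concat X) (f i)"
      using f[of j] eq by (simp add: j)
    with pU have pX: "is_path M (f i) (concat X) (f i)" by (rule is_path_suffix)
    have "is_path M (start M) (concat U @ concat X @ concat Y) (f i)"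
      using f[of l] eq by (simp add: l)
    from is_path_suffix[OF pX is_path_suffix[OF pU this]]
    have pY: "is_path M (f i) (concat Y) (f i)" .
    have "is_path M (start M) (concat U @ concat X @ concat Y @ concat Z @ fs) q"
      using path by (simp add: es all)
    from is_path_suffix[OF pY is_path_suffix[OF pX is_path_suffix[OF pU this]]]
    have pZ: "is_path M (f i) (concat Z @ fs) q" .
    let ?es = "concat (U @ Y @ X @ Z) @ fs"
    have "is_path M (start M) ?es q"
      using pU pX pY pZ by (auto simp: is_path_append)
    moreover have "path_word ?es = concat (map path_word (U @ Y @ X @ Z)) @ z"
      by (simp only: path_word_append path_word_concat fs)
    moreover have "\<forall>i<k. path_count ?es i = 0"
      using count by (simp add: es all path_count_append algebra_simps)
    ultimately have "concat (map path_word (U @ Y @ X @ Z)) @ z \<in> L"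
      using q unfolding L accepts_def by blast
    moreover have "ws = map path_word U @ map path_word X @ map path_word Y @ map path_word Z"
      using ess by (simp add: all)
    ultimately show "\<exists>us xs ys zs. ws = us @ xs @ ys @ zs \<and> xs \<noteq> [] \<and> ys \<noteq> [] \<and>
        concat (us @ ys @ xs @ zs) @ z \<in> L"
      using ne
      by (intro exI[of _ "map path_word U"] exI[of _ "map path_word X"]
          exI[of _ "map path_word Y"] exI[of _ "map path_word Z"]) simp
  qed
qed

section \<open>BS(1,2) as a group of affine maps\<close>

text \<open>
  The letter \<open>t\<close> acts on the rationals as \<open>x \<mapsto> 2x\<close> and \<open>a\<close> as \<open>x \<mapsto> x + 1\<close>. A word \<open>w\<close> acts as
  \<open>x \<mapsto> 2\<^sup>h x + q\<close> with \<open>h = height w\<close> and \<open>q = offset w\<close>.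
\<close>

fun height :: "bs_gen word \<Rightarrow> int" where
  "height [] = 0"
| "height ((Gen_a, b) # w) = height w"
| "height ((Gen_t, b) # w) = (if b then 1 else - 1) + height w"

fun offset :: "bs_gen word \<Rightarrow> rat" where
  "offset [] = 0"
| "offset ((Gen_a, b) # w) = (if b then 1 else - 1) + offset w"
| "offset ((Gen_t, b) # w) = (if b then 2 else 1 / 2) * offset w"

lemma height_append: "height (u @ v) = height u + height v"
  by (induction u rule: height.induct) auto

lemma offset_append: "offset (u @ v) = offset u + 2 powi height u * offset v"
  by (induction u rule: offset.induct)
    (auto simp: power_int_add power_int_minus field_simps)

lemma pres_cong_BS12_affine:
  assumes "pres_cong BS12_relations u v"
  shows "height u = height v \<and> offset u = offset v"
  using assms
proof (induction rule: pres_cong.induct)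
  case (cancel x b)
  show ?case by (cases x) auto
qed (auto simp: BS12_relations_def height_append offset_append)

lemma geodesic_BS12_iff:
  "w \<in> BS12_geodesics \<longleftrightarrow> (\<forall>v. pres_cong BS12_relations v w \<longrightarrow> length w \<le> length v)"
  by (simp add: BS12_geodesics_def geodesic_def BS12_def BS12_gen_def
      word_value_presented_group pres_class_eq_iff)

section \<open>The cost of an integer\<close>

text \<open>
  \<open>costs n g\<close> holds iff \<open>n\<close> has an expansion \<open>\<Sum>i\<le>M. c\<^sub>i 2\<^sup>i\<close> with integer digits such that
  \<open>2M + \<Sum>i\<le>M. \<bar>c\<^sub>i\<bar> \<le> g\<close>. This is the length of a word for \<open>a\<^sup>n\<close> that climbs to height \<open>M\<close>,
  returns to \<open>0\<close> and spells the digits on its way. The bound \<open>g\<close> is an integer, so that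
  differences of bounds need no side conditions.
\<close>

inductive costs :: "int \<Rightarrow> int \<Rightarrow> bool" where
  stop: "\<bar>n\<bar> \<le> g \<Longrightarrow> costs n g"
| climb: "costs n (g - 2 - \<bar>d\<bar>) \<Longrightarrow> costs (2 * n + d) g"

lemma costs_mono: "costs n g \<Longrightarrow> g \<le> g' \<Longrightarrow> costs n g'"
proof (induction arbitrary: g' rule: costs.induct)
  case (stop n g)
  then show ?case by (intro costs.stop) simp
next
  case (climb n g d)
  then show ?case by (intro costs.climb) simp
qed

text \<open>It suffices to change the lowest digit.\<close>

lemma costs_shift: "costs n g \<Longrightarrow> costs (n + e) (g + \<bar>e\<bar>)"
proof (induction rule: costs.induct)
  case (stop n g)
  then show ?case by (intro costs.stop) simp
next
  case (climb n g d)
  from climb.hyps have "costs n (g + \<bar>e\<bar> - 2 - \<bar>d + e\<bar>)"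
    by (rule costs_mono) simp
  from costs.climb[OF this] show ?case by (simp add: algebra_simps)
qed

lemma costs_nonneg: "costs n g \<Longrightarrow> 0 \<le> g"
  by (induction rule: costs.induct) auto

lemma costs_three: "costs 3 g \<Longrightarrow> 3 \<le> g"
proof (erule costs.cases)
  fix n g' d :: int
  assume *: "3 = 2 * n + d" "g = g'" "costs n (g' - 2 - \<bar>d\<bar>)"
  then have "d \<noteq> 0" by presburger
  with costs_nonneg[OF *(3)] show "3 \<le> g" using *(2) by linarith
qed simp

text \<open>
  The lowest digit of an expansion of \<open>2n\<close> is even, say \<open>2d\<close>. Dropping it saves \<open>2\<bar>d\<bar> + 2\<close>, and
  correcting the remaining expansion by \<open>d\<close> costs only \<open>\<bar>d\<bar>\<close>.
\<close>

lemma costs_halve: "costs (2 * n) g \<Longrightarrow> costs n g"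
proof (erule costs.cases)
  fix m g' assume "2 * n = m" "g = g'" "\<bar>m\<bar> \<le> g'"
  then show "costs n g" by (intro costs.stop) linarith
next
  fix m g' d assume *: "2 * n = 2 * m + d" "g = g'" "costs m (g' - 2 - \<bar>d\<bar>)"
  have "costs (m + (n - m)) (g' - 2 - \<bar>d\<bar> + \<bar>n - m\<bar>)"
    using *(3) by (rule costs_shift)
  then show "costs n g" using * by (auto elim: costs_mono)
qed

lemma costs_halve_power: "costs (2 ^ m * n) g \<Longrightarrow> costs n g"
proof (induction m)
  case (Suc m)
  then show ?case using costs_halve[of "2 ^ m * n"] by (simp add: mult.assoc)
qed simp

text \<open>
  The lower bound for geodesics: below a digit string for \<open>n\<close>, the two digits \<open>0\<close> and
  \<open>e = 1\<close> or \<open>e = -1\<close> cannot be written more cheaply than in the obvious way, which costs \<open>1\<close> for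
  the digit and \<open>4\<close> for the two levels. If the two lowest digits of an expansion are \<open>d\<close> and
  \<open>c\<close>, then the rest has to be corrected by \<open>(2c + d - e) / 4\<close>, whose absolute value is less
  than \<open>\<bar>c\<bar> + \<bar>d\<bar>\<close> because \<open>d\<close> is odd. The hypothesis on \<open>n\<close> is for expansions with at most two
  digits. It is sharp: \<open>7 = 4 \<cdot> 2 - 1 = 2 \<cdot> 3 + 1\<close> has cost \<open>6\<close>, whereas \<open>2\<close> has cost \<open>2\<close>.
\<close>

lemma costs_quarter:
  assumes "costs (4 * n + e) g" "\<bar>e\<bar> = 1" "3 \<le> \<bar>n\<bar>"
  shows "costs n (g - 5)"
  using assms(1)
proof (rule costs.cases)
  fix m g' assume "4 * n + e = m" "g = g'" "\<bar>m\<bar> \<le> g'"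
  then show ?thesis using assms by (intro costs.stop) linarith
next
  fix m g' d assume *: "4 * n + e = 2 * m + d" "g = g'" "costs m (g' - 2 - \<bar>d\<bar>)"
  have odd: "1 \<le> \<bar>d\<bar>"
  proof (rule ccontr)
    assume "\<not> ?thesis"
    then have "e = 2 * (m - 2 * n)" using *(1) by simp
    with assms(2) show False by presburger
  qed
  from *(3) show ?thesis
  proof (rule costs.cases)
    fix m' g'' assume "m = m'" "g' - 2 - \<bar>d\<bar> = g''" "\<bar>m'\<bar> \<le> g''"
    then have m: "\<bar>m\<bar> + \<bar>d\<bar> \<le> g - 2" using *(2) by simp
    have "4 * \<bar>n\<bar> \<le> 2 * \<bar>m\<bar> + \<bar>d\<bar> + 1" using *(1) assms(2) by linarith
    then have "\<bar>n\<bar> \<le> g - 5" using m odd assms(3) by linarith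
    then show ?thesis by (rule costs.stop)
  next
    fix p g'' c
    assume **: "m = 2 * p + c" "g' - 2 - \<bar>d\<bar> = g''" "costs p (g'' - 2 - \<bar>c\<bar>)"
    have "costs (p + (n - p)) (g'' - 2 - \<bar>c\<bar> + \<bar>n - p\<bar>)"
      using **(3) by (rule costs_shift)
    note dist = this
    have "4 * (n - p) + e = 2 * c + d" using * ** by simp
    then have "4 * \<bar>n - p\<bar> \<le> 2 * \<bar>c\<bar> + \<bar>d\<bar> + 1" using assms(2) by linarith
    moreover have "k + 1 \<le> C + D" if "4 * k \<le> 2 * C + D + 1" "1 \<le> D" "0 \<le> C" for k C D :: int
      using that by linarith
    ultimately have "\<bar>n - p\<bar> + 1 \<le> \<bar>c\<bar> + \<bar>d\<bar>"
      using odd abs_ge_zero[of c] by blast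
    then show ?thesis using dist * ** by (auto elim: costs_mono)
  qed
qed

text \<open>
  Read \<open>w\<close> as a walk on the heights, which visits the interval from \<open>lo\<close> to \<open>hi\<close>, and let
  \<open>c l\<close> be the exponent sum of the letters \<open>a\<close> read at height \<open>l\<close>. A walk that starts at \<open>0\<close>
  crosses every edge of the interval at least twice, except that the edges between \<open>0\<close> and the final
  height need only one crossing.
\<close>

lemma offset_digits:
  "\<exists>lo hi c. lo \<le> 0 \<and> 0 \<le> hi \<and> lo \<le> height w \<and> height w \<le> hi \<and>
    offset w = (\<Sum>l=lo..hi. of_int (c l) * 2 powi l) \<and>
    (\<Sum>l=lo..hi. \<bar>c l\<bar>) + 2 * (hi - lo) - \<bar>height w\<bar> \<le> int (length w)"
proof (induction w rule: rev_induct)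
  case Nil
  show ?case
    by (rule exI[of _ 0], rule exI[of _ 0], rule exI[of _ "\<lambda>_. 0"]) simp
next
  case (snoc x w)
  then obtain lo hi c where IH: "lo \<le> 0" "0 \<le> hi" "lo \<le> height w" "height w \<le> hi"
      "offset w = (\<Sum>l=lo..hi. of_int (c l) * 2 powi l)"
      "(\<Sum>l=lo..hi. \<bar>c l\<bar>) + 2 * (hi - lo) - \<bar>height w\<bar> \<le> int (length w)" by blast
  obtain g b where x: "x = (g, b)" by (cases x)
  show ?case
  proof (cases g)
    case Gen_a
    define h where "h = height w"
    define s :: int where "s = (if b then 1 else - 1)"
    define c' where "c' = c(h := c h + s)"
    have h: "h \<in> {lo..hi}" using IH by (simp add: h_def)
    have "(\<Sum>l=lo..hi. of_int (c' l) * 2 powi l :: rat)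
        = of_int (c h + s) * 2 powi h + (\<Sum>l\<in>{lo..hi} - {h}. of_int (c l) * 2 powi l)"
      using h by (simp add: sum.remove[of _ h] c'_def)
    also have "\<dots> = offset w + of_int s * 2 powi h"
      using h by (simp add: IH(5) sum.remove[of _ h] algebra_simps)
    also have "\<dots> = offset (w @ [x])"
      by (simp add: offset_append x Gen_a s_def h_def)
    finally have 1: "offset (w @ [x]) = (\<Sum>l=lo..hi. of_int (c' l) * 2 powi l)" ..
    have "(\<Sum>l=lo..hi. \<bar>c' l\<bar>) = \<bar>c h + s\<bar> + (\<Sum>l\<in>{lo..hi} - {h}. \<bar>c l\<bar>)"
      using h by (simp add: sum.remove[of _ h] c'_def)
    also have "\<dots> \<le> (\<Sum>l=lo..hi. \<bar>c l\<bar>) + 1"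
      using h by (simp add: sum.remove[of _ h] s_def) arith
    finally have 2: "(\<Sum>l=lo..hi. \<bar>c' l\<bar>) \<le> (\<Sum>l=lo..hi. \<bar>c l\<bar>) + 1" .
    have 3: "height (w @ [x]) = height w" by (simp add: height_append x Gen_a)
    show ?thesis
      using IH 1 2 3 by (intro exI[of _ lo] exI[of _ hi] exI[of _ c']) simp
  next
    case Gen_t
    define s :: int where "s = (if b then 1 else - 1)"
    define lo' hi' where "lo' = min lo (height w + s)" and "hi' = max hi (height w + s)"
    define c' where "c' l = (if l \<in> {lo..hi} then c l else 0)" for l
    have sub: "{lo..hi} \<subseteq> {lo'..hi'}" by (auto simp: lo'_def hi'_def)
    have 1: "(\<Sum>l=lo'..hi'. of_int (c' l) * 2 powi l :: rat) = offset w"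
      using sub unfolding IH(5) by (intro sum.mono_neutral_cong_right) (auto simp: c'_def)
    have 2: "(\<Sum>l=lo'..hi'. \<bar>c' l\<bar>) = (\<Sum>l=lo..hi. \<bar>c l\<bar>)"
      using sub by (intro sum.mono_neutral_cong_right) (auto simp: c'_def)
    have 3: "height (w @ [x]) = height w + s" by (simp add: height_append x Gen_t s_def)
    have 4: "offset (w @ [x]) = offset w" by (simp add: offset_append x Gen_t)
    have 5: "2 * (hi' - lo') - \<bar>height w + s\<bar> \<le> 2 * (hi - lo) - \<bar>height w\<bar> + 1"
      using IH(1-4) unfolding lo'_def hi'_def s_def max_def min_def
      by (cases b; cases "0 \<le> height w") (simp_all, linarith+)
    have "lo' \<le> 0 \<and> 0 \<le> hi' \<and> lo' \<le> height w + s \<and> height w + s \<le> hi'"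
      using IH(1-2) by (auto simp: lo'_def hi'_def)
    then show ?thesis
      using IH(6) 5 unfolding 3 4
      by (intro exI[of _ lo'] exI[of _ hi'] exI[of _ c']) (simp add: 1 2)
  qed
qed

text \<open>Horner evaluation of the digits, starting from the highest one.\<close>

lemma costs_digits:
  "\<exists>n. costs n ((\<Sum>l=hi - int m..hi. \<bar>c l\<bar>) + 2 * int m) \<and>
    (\<Sum>l=hi - int m..hi. of_int (c l) * 2 powi l) = (of_int n * 2 powi (hi - int m) :: rat)"
proof (induction m)
  case 0
  show ?case by (intro exI[of _ "c hi"]) (simp add: costs.stop)
next
  case (Suc m)
  define lo where "lo = hi - int (Suc m)"
  have lo: "hi - int m = lo + 1" by (simp add: lo_def)
  have split: "{lo..hi} = insert lo {lo + 1..hi}" by (auto simp: lo_def)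
  from Suc obtain n where n: "costs n ((\<Sum>l=lo + 1..hi. \<bar>c l\<bar>) + 2 * int m)"
    "(\<Sum>l=lo + 1..hi. of_int (c l) * 2 powi l) = (of_int n * 2 powi (lo + 1) :: rat)"
    unfolding lo by blast
  have "costs (2 * n + c lo) ((\<Sum>l=lo..hi. \<bar>c l\<bar>) + 2 * int (Suc m))"
    using n(1) by (intro costs.climb) (simp add: split)
  moreover have "(\<Sum>l=lo..hi. of_int (c l) * 2 powi l) = (of_int (2 * n + c lo) * 2 powi lo :: rat)"
    unfolding split by (simp add: n(2)[unfolded add.commute[of lo]] power_int_add algebra_simps)
  ultimately show ?case unfolding lo_def by blast
qed

text \<open>
  The walk of \<open>w\<close> may go below height \<open>0\<close>, down to some \<open>- m\<close>. Seen from its lowest point it spells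
  \<open>2\<^sup>m n\<close> instead of \<open>n\<close>, which by \<open>costs_halve_power\<close> cannot be cheaper.
\<close>

lemma costs_le_length:
  assumes "height w = 0" "offset w = of_int n"
  shows "costs n (int (length w))"
proof -
  obtain lo hi c where w: "lo \<le> 0" "0 \<le> hi"
      "of_int n = (\<Sum>l=lo..hi. of_int (c l) * 2 powi l :: rat)"
      "(\<Sum>l=lo..hi. \<bar>c l\<bar>) + 2 * (hi - lo) \<le> int (length w)"
    using offset_digits[of w] assms by auto
  have hi: "hi - int (nat (hi - lo)) = lo" using w by simp
  obtain n' where n': "costs n' ((\<Sum>l=lo..hi. \<bar>c l\<bar>) + 2 * int (nat (hi - lo)))"
      "of_int n = (of_int n' * 2 powi lo :: rat)"
    using costs_digits[where hi = hi and m = "nat (hi - lo)" and c = c] unfolding hi w(3) by auto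
  obtain m where m: "lo = - int m" using w(1) by (metis minus_minus nonneg_int_cases neg_0_le_iff_le)
  have "of_int n' = (of_int (2 ^ m * n) :: rat)"
    using n'(2) by (simp add: m power_int_minus field_simps)
  then have "n' = 2 ^ m * n" by (simp only: of_int_eq_iff)
  then have "costs n ((\<Sum>l=lo..hi. \<bar>c l\<bar>) + 2 * int (nat (hi - lo)))"
    using n'(1) costs_halve_power by blast
  then show ?thesis using w by (auto elim: costs_mono)
qed

section \<open>Excursions\<close>

text \<open>
  The bits are listed from the lowest height upwards, two heights apart. A bit \<open>True\<close> is a digit
  \<open>1\<close>, which is spelled on the way up, and a bit \<open>False\<close> is a digit \<open>-1\<close>, which is spelled on the
  way down.
\<close>

fun ascent :: "bool list \<Rightarrow> bs_gen word" where
  "ascent [] = []"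
| "ascent (b # bs) =
    (if b then [(Gen_a, True)] else []) @ [(Gen_t, True), (Gen_t, True)] @ ascent bs"

fun descent :: "bool list \<Rightarrow> bs_gen word" where
  "descent [] = []"
| "descent (b # bs) =
    descent bs @ [(Gen_t, False), (Gen_t, False)] @ (if b then [] else [(Gen_a, False)])"

text \<open>
  The way up and the way down take separate bit lists because an exchange of factors of the ascent
  affects the first one only.
\<close>

definition excursion :: "bool list \<Rightarrow> bool list \<Rightarrow> bs_gen word" where
  "excursion us ds = ascent us @ replicate 3 (Gen_a, True) @ descent ds"

lemma ascent_append: "ascent (us @ vs) = ascent us @ ascent vs"
  by (induction us) auto

lemma descent_append: "descent (us @ vs) = descent vs @ descent us"
  by (induction us) auto

lemma ascent_concat: "ascent (concat bss) = concat (map ascent bss)"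
  by (induction bss) (auto simp: ascent_append)

text \<open>The digit \<open>3\<close> at the top is the smallest that \<open>costs_quarter\<close> admits.\<close>

fun excursion_value :: "bool list \<Rightarrow> int" where
  "excursion_value [] = 3"
| "excursion_value (b # bs) = 4 * excursion_value bs + (if b then 1 else - 1)"

lemma excursion_value_ge: "3 \<le> excursion_value bs"
  by (induction bs) auto

lemma costs_excursion_value: "costs (excursion_value bs) g \<Longrightarrow> 5 * int (length bs) + 3 \<le> g"
proof (induction bs arbitrary: g)
  case Nil
  then show ?case using costs_three by simp
next
  case (Cons b bs)
  have "costs (excursion_value bs) (g - 5)"
    using Cons.prems excursion_value_ge[of bs]
    by (intro costs_quarter[of _ "if b then 1 else - 1"]) auto
  from Cons.IH[OF this] show ?case by simp
qed

lemma excursion_Cons: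
  "excursion (u # us) (d # ds) =
    (if u then [(Gen_a, True)] else []) @
    ([(Gen_t, True), (Gen_t, True)] @ excursion us ds @ [(Gen_t, False), (Gen_t, False)]) @
    (if d then [] else [(Gen_a, False)])"
  by (simp add: excursion_def)

lemma excursion_self:
  "height (excursion bs bs) = 0 \<and> offset (excursion bs bs) = of_int (excursion_value bs) \<and>
    length (excursion bs bs) = 5 * length bs + 3"
proof (induction bs)
  case Nil
  show ?case by (simp add: excursion_def eval_nat_numeral)
next
  case (Cons b bs)
  then show ?case by (auto simp: excursion_Cons height_append offset_append)
qed

lemma geodesic_excursion: "excursion bs bs \<in> BS12_geodesics"
  unfolding geodesic_BS12_iff
proof (intro allI impI)
  fix v assume "pres_cong BS12_relations v (excursion bs bs)"
  then have "height v = 0" "offset v = of_int (excursion_value bs)"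
    using pres_cong_BS12_affine[of v] excursion_self[of bs] by auto
  then have "costs (excursion_value bs) (int (length v))" by (rule costs_le_length)
  from costs_excursion_value[OF this] show "length (excursion bs bs) \<le> length v"
    using excursion_self[of bs] by simp
qed

definition a_power :: "bs_gen word \<Rightarrow> bool" where
  "a_power w \<longleftrightarrow> (\<exists>k b. pres_cong BS12_relations w (replicate k (Gen_a, b)))"

lemma pres_cong_context: "pres_cong R u v \<Longrightarrow> pres_cong R (p @ u @ q) (p @ v @ q)"
  by (intro pres_cong.append pres_cong.refl)

lemma pres_cong_cancel_left: "pres_cong R ((x, b) # (x, \<not> b) # w) w"
  using pres_cong.append[OF pres_cong.cancel[of R x b] pres_cong.refl[of R w]] by simp

lemma a_power_congI:
  "pres_cong BS12_relations w v \<Longrightarrow> a_power v \<Longrightarrow> a_power w"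
  unfolding a_power_def using pres_cong.trans by blast

lemma a_power_replicate: "a_power (replicate k (Gen_a, b))"
  unfolding a_power_def using pres_cong.refl by blast

lemma a_power_Cons:
  assumes "a_power w"
  shows "a_power ((Gen_a, b) # w)"
proof -
  from assms obtain k b' where w: "pres_cong BS12_relations w (replicate k (Gen_a, b'))"
    by (auto simp: a_power_def)
  have "pres_cong BS12_relations ((Gen_a, b) # w) ((Gen_a, b) # replicate k (Gen_a, b'))"
    using pres_cong_context[OF w, of "[(Gen_a, b)]" "[]"] by simp
  moreover have "a_power ((Gen_a, b) # replicate k (Gen_a, b'))"
  proof (cases "k = 0 \<or> b' = b")
    case True
    then show ?thesis using a_power_replicate[of "Suc k" b] by auto
  next
    case False
    then obtain k' where "k = Suc k'" "b' = (\<not> b)" by (cases k) auto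
    then show ?thesis
      using a_power_congI[OF pres_cong_cancel_left a_power_replicate] by simp
  qed
  ultimately show ?thesis by (rule a_power_congI)
qed

lemma a_power_commute:
  assumes "a_power w"
  shows "pres_cong BS12_relations (w @ [(Gen_a, b)]) ((Gen_a, b) # w)"
proof -
  from assms obtain k b' where w: "pres_cong BS12_relations w (replicate k (Gen_a, b'))"
    by (auto simp: a_power_def)
  have eq: "pres_cong BS12_relations (replicate k (Gen_a, b') @ [(Gen_a, b)])
      ((Gen_a, b) # replicate k (Gen_a, b'))"
  proof (cases "k = 0 \<or> b' = b")
    case True
    then show ?thesis by (auto simp: replicate_append_same intro: pres_cong.refl)
  next
    case False
    then obtain k' where k: "k = Suc k'" "b' = (\<not> b)" by (cases k) auto
    let ?r = "replicate k' (Gen_a, \<not> b)"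
    have "pres_cong BS12_relations (?r @ [(Gen_a, \<not> b), (Gen_a, b)]) ?r"
      using pres_cong_context[OF pres_cong.cancel[of _ Gen_a "\<not> b"], where p = ?r and q = "[]"]
      by simp
    moreover have "pres_cong BS12_relations ?r ((Gen_a, b) # (Gen_a, \<not> b) # ?r)"
      by (rule pres_cong.sym[OF pres_cong_cancel_left])
    ultimately have "pres_cong BS12_relations (?r @ [(Gen_a, \<not> b), (Gen_a, b)])
        ((Gen_a, b) # (Gen_a, \<not> b) # ?r)"
      by (rule pres_cong.trans)
    moreover have "replicate k (Gen_a, b') @ [(Gen_a, b)] = ?r @ [(Gen_a, \<not> b), (Gen_a, b)]"
      by (simp add: k replicate_app_Cons_same)
    ultimately show ?thesis by (simp add: k)
  qed
  have "pres_cong BS12_relations (w @ [(Gen_a, b)]) (replicate k (Gen_a, b') @ [(Gen_a, b)])"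
    using pres_cong_context[OF w, of "[]" "[(Gen_a, b)]"] by simp
  moreover
  have "pres_cong BS12_relations ((Gen_a, b) # replicate k (Gen_a, b')) ((Gen_a, b) # w)"
    using pres_cong_context[OF pres_cong.sym[OF w], of "[(Gen_a, b)]" "[]"] by simp
  ultimately show ?thesis by (rule pres_cong.trans[OF _ pres_cong.trans[OF eq]])
qed

lemma a_power_snoc: "a_power w \<Longrightarrow> a_power (w @ [(Gen_a, b)])"
  using a_power_congI[OF a_power_commute a_power_Cons] .

text \<open>
  For \<open>b = True\<close> this is the defining relation; the other case follows by multiplying it with inverses.
\<close>

lemma BS12_double:
  "pres_cong BS12_relations [(Gen_t, True), (Gen_a, b), (Gen_t, False)] [(Gen_a, b), (Gen_a, b)]"
proof (cases b)
  case True
  then show ?thesis by (auto simp: BS12_relations_def intro!: pres_cong.relation)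
next
  case False
  let ?c = "pres_cong BS12_relations" and ?A = "[(Gen_a, False), (Gen_a, False)]"
    and ?m = "[(Gen_t, True), (Gen_a, True), (Gen_t, False)]"
    and ?n = "[(Gen_t, True), (Gen_a, False), (Gen_t, False)]"
  have r: "?c ?m [(Gen_a, True), (Gen_a, True)]"
    by (auto simp: BS12_relations_def intro!: pres_cong.relation)
  have inv: "?c (rev (map (\<lambda>(x, b). (x, \<not> b)) w) @ w) []" for w
    by (rule pres_cong_inverse)
  have "?c (?A @ [(Gen_a, True), (Gen_a, True)]) []"
    using inv[of "[(Gen_a, True), (Gen_a, True)]"] by simp
  from pres_cong.append[OF this pres_cong.refl[of _ ?n]]
  have 1: "?c (?A @ [(Gen_a, True), (Gen_a, True)] @ ?n) ?n" by simp
  have 2: "?c (?A @ ?m @ ?n) (?A @ [(Gen_a, True), (Gen_a, True)] @ ?n)"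
    using r by (rule pres_cong_context)
  have "?c (?m @ ?n) []"
    using inv[of ?n] by simp
  from pres_cong_context[OF this, of ?A "[]"] have 3: "?c (?A @ ?m @ ?n) ?A" by simp
  show ?thesis
    using pres_cong.trans[OF pres_cong.sym[OF pres_cong.trans[OF 2 1]] 3] False by simp
qed

lemma a_power_conjugate:
  assumes "a_power w"
  shows "a_power ([(Gen_t, True)] @ w @ [(Gen_t, False)])"
proof -
  let ?c = "pres_cong BS12_relations"
  from assms obtain k b where w: "?c w (replicate k (Gen_a, b))"
    by (auto simp: a_power_def)
  have "?c ([(Gen_t, True)] @ replicate k (Gen_a, b) @ [(Gen_t, False)])
      (replicate (2 * k) (Gen_a, b))"
  proof (induction k)
    case 0
    show ?case using pres_cong.cancel[of _ Gen_t True] by simp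
  next
    case (Suc k)
    let ?r = "replicate k (Gen_a, b) @ [(Gen_t, False)]"
    let ?v = "[(Gen_t, True), (Gen_a, b), (Gen_t, False), (Gen_t, True)] @ ?r"
    have 1: "?c ?v ([(Gen_t, True)] @ replicate (Suc k) (Gen_a, b) @ [(Gen_t, False)])"
      using pres_cong_context[OF pres_cong.cancel[of _ Gen_t False],
          where p = "[(Gen_t, True), (Gen_a, b)]" and q = ?r] by simp
    have 2: "?c ?v (replicate (2 * Suc k) (Gen_a, b))"
      using pres_cong.append[OF BS12_double Suc.IH] by simp
    show ?case by (rule pres_cong.trans[OF pres_cong.sym[OF 1] 2])
  qed
  from a_power_congI[OF pres_cong.trans[OF pres_cong_context[OF w] this] a_power_replicate]
  show ?thesis .
qed

lemma a_power_conjugate2: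
  "a_power w \<Longrightarrow> a_power ([(Gen_t, True), (Gen_t, True)] @ w @ [(Gen_t, False), (Gen_t, False)])"
  using a_power_conjugate[OF a_power_conjugate[of w]] by simp

lemma a_power_excursion: "length us = length ds \<Longrightarrow> a_power (excursion us ds)"
proof (induction us ds rule: list_induct2)
  case Nil
  show ?case using a_power_replicate[of 3 True] by (simp add: excursion_def)
next
  case (Cons u us d ds)
  let ?m = "[(Gen_t, True), (Gen_t, True)] @ excursion us ds @ [(Gen_t, False), (Gen_t, False)]"
  have "a_power ?m" using Cons.IH by (rule a_power_conjugate2)
  then have "a_power (?m @ (if d then [] else [(Gen_a, False)]))"
    using a_power_snoc[of ?m] by (cases d) (simp_all only: if_True if_False append_Nil2)
  from this a_power_Cons[OF this] show ?case
    unfolding excursion_Cons by (cases u) simp_all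
qed

text \<open>
  The letter \<open>a\<close> of the bit \<open>True\<close> on the way up and the letter \<open>a\<^sup>-\<^sup>1\<close> of the bit \<open>False\<close> on the way
  down enclose a word for a power of \<open>a\<close>, with which they commute, so both can be deleted.
\<close>

lemma not_geodesic_excursion:
  assumes "length us = length ds"
  shows "excursion (p @ True # us) (q @ False # ds) \<notin> BS12_geodesics"
proof -
  let ?c = "pres_cong BS12_relations"
  let ?m = "[(Gen_t, True), (Gen_t, True)] @ excursion us ds @ [(Gen_t, False), (Gen_t, False)]"
  have "a_power ?m" using assms by (intro a_power_conjugate2 a_power_excursion)
  from pres_cong_context[OF a_power_commute[OF this, of False], of "[(Gen_a, True)]" "[]"]
  have "?c ([(Gen_a, True)] @ ?m @ [(Gen_a, False)]) ((Gen_a, True) # (Gen_a, False) # ?m)"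
    by simp
  moreover have "?c ((Gen_a, True) # (Gen_a, False) # ?m) ?m"
    using pres_cong_cancel_left[of _ Gen_a True] by simp
  ultimately have "?c ([(Gen_a, True)] @ ?m @ [(Gen_a, False)]) ?m"
    by (rule pres_cong.trans)
  from pres_cong_context[OF this, of "ascent p" "descent q"]
  have "?c (excursion (p @ True # us) (q @ False # ds)) (ascent p @ ?m @ descent q)"
    by (simp add: excursion_def ascent_append descent_append)
  moreover have "length (ascent p @ ?m @ descent q) < length (excursion (p @ True # us) (q @ False # ds))"
    by (simp add: excursion_def ascent_append descent_append)
  ultimately show ?thesis
    unfolding geodesic_BS12_iff using pres_cong.sym linorder_not_less by blast
qed

section \<open>Excursions over growing blocks\<close>

definition block :: "nat \<Rightarrow> bool list" where
  "block j = False # replicate j True"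

text \<open>
  Let \<open>xs\<close> start with \<open>block i\<close> and \<open>ys\<close> with \<open>block j\<close>. Blocks get longer, so \<open>i < j\<close>. After
  \<open>False\<close> and \<open>i\<close> times \<open>True\<close>, the original list continues with the \<open>False\<close> of the next block,
  whereas \<open>block j\<close>, which comes first after the exchange, still has a \<open>True\<close>. Since \<open>False\<close> is
  replaced by \<open>True\<close>, this is the direction of mismatch that \<open>not_geodesic_excursion\<close> requires.
\<close>

lemma block_swap_mismatch:
  assumes "map block [0..<n] = us @ xs @ ys @ zs" "xs \<noteq> []" "ys \<noteq> []"
  obtains p q r where "concat (us @ xs @ ys @ zs) = p @ False # q"
    "concat (us @ ys @ xs @ zs) = p @ True # r" "length q = length r"
proof -
  obtain x xs' where xs: "xs = x # xs'" using assms(2) by (cases xs) auto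
  obtain y ys' where ys: "ys = y # ys'" using assms(3) by (cases ys) auto
  let ?i = "length us" and ?j = "length us + length xs"
  have len: "n = length (us @ xs @ ys @ zs)"
    using arg_cong[OF assms(1), of length] by simp
  have nth: "(us @ xs @ ys @ zs) ! i = block i" if "i < n" for i
    using that unfolding assms(1)[symmetric] by simp
  have x: "x = block ?i" using nth[of ?i] len by (simp add: xs)
  have y: "y = block ?j" using nth[of ?j] len by (simp add: xs ys nth_append)
  have "\<exists>s. concat (xs' @ ys @ zs) = False # s"
  proof -
    obtain b bs where b: "xs' @ ys @ zs = b # bs" using ys by (cases xs') auto
    then have "b \<in> set (us @ xs @ ys @ zs)" by (simp add: xs)
    then have "b \<in> block ` {0..<n}" unfolding assms(1)[symmetric] by simp
    with b show ?thesis by (auto simp: block_def)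
  qed
  then obtain s where s: "concat (xs' @ ys @ zs) = False # s" ..
  have "?j = ?i + Suc (length xs')" by (simp add: xs)
  then have y': "y = block ?i @ True # replicate (length xs') True"
    unfolding y block_def by (simp add: replicate_add replicate_app_Cons_same)
  let ?p = "concat us @ block ?i"
  let ?r = "replicate (length xs') True @ concat (ys' @ xs @ zs)"
  have 1: "concat (us @ xs @ ys @ zs) = ?p @ False # s"
    using s by (simp add: xs x)
  have 2: "concat (us @ ys @ xs @ zs) = ?p @ True # ?r"
    by (simp add: ys y')
  have "length (concat (us @ xs @ ys @ zs)) = length (concat (us @ ys @ xs @ zs))"
    by simp
  then have "length s = length ?r" unfolding 1 2 by simp
  with 1 2 show thesis by (rule that)
qed

theorem theorem6p1: "\<not> counter (UNIV :: bs_gen letter set) BS12_geodesics"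
proof
  assume "counter (UNIV :: bs_gen letter set) BS12_geodesics"
  then obtain k where "k_counter (UNIV :: bs_gen letter set) k BS12_geodesics"
    by (auto simp: counter_def)
  from k_counter_adjacent_swap[OF this] obtain N where N: "\<And>ws z. N \<le> length ws \<Longrightarrow>
      concat ws @ z \<in> BS12_geodesics \<Longrightarrow> \<exists>us xs ys zs. ws = us @ xs @ ys @ zs \<and>
        xs \<noteq> [] \<and> ys \<noteq> [] \<and> concat (us @ ys @ xs @ zs) @ z \<in> BS12_geodesics"
    by blast
  \<comment> \<open>Only the block boundaries of the ascent serve as cuts; the top and the whole descent form
    the suffix \<open>z\<close> and stay in place.\<close>
  define bss where "bss = map block [0..<N]"
  define z where "z = replicate 3 (Gen_a, True) @ descent (concat bss)"
  have exc: "concat (map ascent cs) @ z = excursion (concat cs) (concat bss)" for cs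
    by (simp add: excursion_def z_def ascent_concat)
  have "concat (map ascent bss) @ z \<in> BS12_geodesics"
    unfolding exc by (rule geodesic_excursion)
  with N[of "map ascent bss" z] obtain us xs ys zs
    where split: "map ascent bss = us @ xs @ ys @ zs" and ne: "xs \<noteq> []" "ys \<noteq> []"
      and geo: "concat (us @ ys @ xs @ zs) @ z \<in> BS12_geodesics"
    by (auto simp: bss_def)
  from split obtain us' vs where 1: "bss = us' @ vs" "us = map ascent us'"
      "map ascent vs = xs @ ys @ zs"
    by (metis map_eq_append_conv)
  from 1(3) obtain xs' vs' where 2: "vs = xs' @ vs'" "xs = map ascent xs'"
      "map ascent vs' = ys @ zs"
    by (metis map_eq_append_conv)
  from 2(3) obtain ys' zs' where 3: "vs' = ys' @ zs'" "ys = map ascent ys'" "zs = map ascent zs'"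
    by (metis map_eq_append_conv)
  have bss: "bss = us' @ xs' @ ys' @ zs'" by (simp add: 1 2 3)
  note maps = 1(2) 2(2) 3(2,3)
  have "xs' \<noteq> []" "ys' \<noteq> []" using ne maps by auto
  with bss obtain p q r where pqr: "concat bss = p @ False # q"
      "concat (us' @ ys' @ xs' @ zs') = p @ True # r" "length q = length r"
    unfolding bss_def using block_swap_mismatch[of N us' xs' ys' zs'] by metis
  have "concat (us @ ys @ xs @ zs) @ z = excursion (p @ True # r) (p @ False # q)"
    using exc[of "us' @ ys' @ xs' @ zs'"] pqr by (simp add: maps)
  with geo not_geodesic_excursion[of r q p p] pqr(3) show False by simp
qed

end
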